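(* Let $\mathcal{R}$ be a partial selection rule which never selects a $sat\_cl5$-atom whose first and third arguments are both variables, and which selects some atom in each query containing at least one atom not of this form. Let $Q_0=sat(u,l)$, where $u$ is a representation of a propositional formula in CNF and $l$ is the list of the variables in $u$. Then no SLD-derivation of $P_3$ for $Q_0$ via $\mathcal{R}$ flounders.
   Context: Prolog list notation is used ($[\,]$ is a constant, $[h|t]$ a binary constructor); $-$ is a binary function symbol written infix; $\mathtt{true},\mathtt{false}$ are constants. Representation of CNF formulae: propositional variables are represented as logical variables; a positive literal $x$ is represented as the term $\mathtt{true}-X$, a negative literal $\neg x$ as $\mathtt{false}-X$; a clause is represented as the list of the representations of its literals, and a conjunction of clauses as the list of the representations of the clauses. A partial selection rule is a selection rule for SLD-resolution that may be a partial function: in some non-empty queries no atom may be selected. A non-empty query in which no atom is selected is called floundered; a derivation flounders if a floundered query occurs in it. A $p$-atom is an atom with predicate symbol $p$. The definite clause program $P_3$ consists of the following rules (names beginning with upper-case letters are variables): 1. $sat\_cnf([\,])$. 2. $sat\_cnf([C|Cs])\gets sat\_cl(C), sat\_cnf(Cs)$. 3. $sat\_cl([P-V|R])\gets sat\_cl3(R,V,P)$. 4. ${=}(X,X)$. 5. $sat\_cl3([\,],V,P)\gets V=P$. 6. $sat\_cl3([P_2-V_2|R],V_1,P_1)\gets sat\_cl5(V_1,P_1,V_2,P_2,R)$. 7. $sat\_cl5(V_1,P_1,V_2,P_2,R)\gets sat\_cl5a(V_1,P_1,V_2,P_2,R)$. 8. $sat\_cl5(V_1,P_1,V_2,P_2,R)\gets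 sat\_cl5a(V_2,P_2,V_1,P_1,R)$. 9. $sat\_cl5a(V_1,P_1,V_2,P_2,R)\gets V_1=P_1$. 10. $sat\_cl5a(V_1,P_1,V_2,P_2,R)\gets sat\_cl3(R,V_2,P_2)$. 11. $sat(Cs,Vs)\gets sat\_cnf(Cs), tflist(Vs)$. 12. $tflist([\,])$. 13. $tflist([V|Vs])\gets tflist(Vs), tf(V)$. 14. $tf(\mathtt{true})$. 15. $tf(\mathtt{false})$. *)

theory Defs
  imports Main
begin

section \<open>Terms, atoms, definite clauses\<close>

text \<open>A symbol is identified by its name together with the number of its arguments, as in Prolog.\<close>

datatype (vars_trm: 'v) trm = Var 'v | Fun string "'v trm list"

datatype (vars_atom: 'v) atom = Atom string "'v trm list"

datatype (vars_clause: 'v) clause =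
  Clause (clause_head: "'v atom") (clause_body: "'v atom list") (infix \<open>\<longleftarrow>\<close> 50)

type_synonym 'v query = "'v atom list"
type_synonym 'v program = "'v clause set"
type_synonym 'v subst = "'v \<Rightarrow> 'v trm"

definition vars_query :: "'v query \<Rightarrow> 'v set" where
  "vars_query Q = (\<Union>A\<in>set Q. vars_atom A)"

text \<open>\<open>c'\<close> is \<open>c\<close> with its variables renamed by a permutation.\<close>

definition variant :: "'v clause \<Rightarrow> 'v clause \<Rightarrow> bool" where
  "variant c' c \<longleftrightarrow> (\<exists>\<pi>. bij \<pi> \<and> c' = map_clause \<pi> c)"


section \<open>Substitutions and most general unifiers\<close>

primrec subst_trm :: "'v subst \<Rightarrow> 'v trm \<Rightarrow> 'v trm" where
  "subst_trm \<theta> (Var x) = \<theta> x"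
| "subst_trm \<theta> (Fun f ts) = Fun f (map (subst_trm \<theta>) ts)"

primrec subst_atom :: "'v subst \<Rightarrow> 'v atom \<Rightarrow> 'v atom" where
  "subst_atom \<theta> (Atom p ts) = Atom p (map (subst_trm \<theta>) ts)"

definition subst_dom :: "'v subst \<Rightarrow> 'v set" where
  "subst_dom \<theta> = {x. \<theta> x \<noteq> Var x}"

definition vars_subst :: "'v subst \<Rightarrow> 'v set" where
  "vars_subst \<theta> = subst_dom \<theta> \<union> (\<Union>x\<in>subst_dom \<theta>. vars_trm (\<theta> x))"

text \<open>Substitutions in logic programming are finite mappings, hence the finiteness condition.\<close>

definition unifier :: "'v subst \<Rightarrow> 'v atom \<Rightarrow> 'v atom \<Rightarrow> bool" where
  "unifier \<theta> A B \<longleftrightarrow> finite (subst_dom \<theta>) \<and> subst_atom \<theta> A = subst_atom \<theta> B"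

definition mgu :: "'v subst \<Rightarrow> 'v atom \<Rightarrow> 'v atom \<Rightarrow> bool" where
  "mgu \<theta> A B \<longleftrightarrow> unifier \<theta> A B \<and>
     (\<forall>\<sigma>. unifier \<sigma> A B \<longrightarrow> (\<exists>\<delta>. \<forall>x. \<sigma> x = subst_trm \<delta> (\<theta> x)))"


section \<open>SLD-derivations\<close>

text \<open>
  A step records the query, the position of its selected atom, the (renamed) input clause and
  the mgu. An initial fragment of a derivation is the list of the steps made so far together
  with the last query. The premise on variables is standardization apart: the input clause
  shares no variable with the initial query, nor with earlier input clauses and mgus.
\<close>

datatype 'v step =
  Step (step_query: "'v query") (step_pos: nat) (step_clause: "'v clause") (step_mgu: "'v subst")

inductive sld_fragment :: "'v program \<Rightarrow> 'v query \<Rightarrow> 'v step list \<Rightarrow> 'v query \<Rightarrow> bool"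
  for P Q\<^sub>0 where
  start: "sld_fragment P Q\<^sub>0 [] Q\<^sub>0"
| step: "sld_fragment P Q\<^sub>0 (ss @ [Step Q i c \<theta>])
           (map (subst_atom \<theta>) (take i Q @ clause_body c @ drop (Suc i) Q))"
  if "sld_fragment P Q\<^sub>0 ss Q"
    and "i < length Q"
    and "c\<^sub>0 \<in> P" and "variant c c\<^sub>0"
    and "vars_clause c \<inter>
         (vars_query Q\<^sub>0 \<union> (\<Union>s\<in>set ss. vars_clause (step_clause s) \<union> vars_subst (step_mgu s))) = {}"
    and "mgu \<theta> (Q ! i) (clause_head c)"

text \<open>
  A selection rule may depend on the whole initial fragment, not just on its last query;
  \<open>None\<close> means that no atom is selected.
\<close>

type_synonym 'v selection_rule = "'v step list \<Rightarrow> 'v query \<Rightarrow> nat option"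

definition partial_selection_rule :: "'v program \<Rightarrow> 'v selection_rule \<Rightarrow> bool" where
  "partial_selection_rule P R \<longleftrightarrow>
     (\<forall>Q\<^sub>0 ss Q i. sld_fragment P Q\<^sub>0 ss Q \<longrightarrow> R ss Q = Some i \<longrightarrow> i < length Q)"

definition sld_fragment_via ::
  "'v program \<Rightarrow> 'v selection_rule \<Rightarrow> 'v query \<Rightarrow> 'v step list \<Rightarrow> 'v query \<Rightarrow> bool" where
  "sld_fragment_via P R Q\<^sub>0 ss Q \<longleftrightarrow> sld_fragment P Q\<^sub>0 ss Q \<and>
     (\<forall>n < length ss. R (take n ss) (step_query (ss ! n)) = Some (step_pos (ss ! n)))"

datatype 'v derivation = FinDeriv "'v step list" "'v query" | InfDeriv "nat \<Rightarrow> 'v step"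

primrec fragments :: "'v derivation \<Rightarrow> ('v step list \<times> 'v query) set" where
  "fragments (FinDeriv ss Q) =
     insert (ss, Q) {(take n ss, step_query (ss ! n)) | n. n < length ss}"
| "fragments (InfDeriv s) = {(map s [0..<n], step_query (s n)) | n. True}"

text \<open>Derivations are not required to be maximal.\<close>

definition sld_derivation_via ::
  "'v program \<Rightarrow> 'v selection_rule \<Rightarrow> 'v query \<Rightarrow> 'v derivation \<Rightarrow> bool" where
  "sld_derivation_via P R Q\<^sub>0 d \<longleftrightarrow> (\<forall>(ss, Q)\<in>fragments d. sld_fragment_via P R Q\<^sub>0 ss Q)"

definition flounders :: "'v selection_rule \<Rightarrow> 'v derivation \<Rightarrow> bool" where
  "flounders R d \<longleftrightarrow> (\<exists>(ss, Q)\<in>fragments d. Q \<noteq> [] \<and> R ss Q = None)"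


section \<open>Representation of CNF formulae\<close>

abbreviation tt :: "'v trm" where "tt \<equiv> Fun ''true'' []"
abbreviation ff :: "'v trm" where "ff \<equiv> Fun ''false'' []"
abbreviation pnil :: "'v trm" where "pnil \<equiv> Fun ''[]'' []"

abbreviation pcons :: "'v trm \<Rightarrow> 'v trm \<Rightarrow> 'v trm" (infixr \<open>\<bullet>\<close> 65) where
  "h \<bullet> t \<equiv> Fun ''[|]'' [h, t]"

abbreviation pminus :: "'v trm \<Rightarrow> 'v trm \<Rightarrow> 'v trm" (infix \<open>\<ominus>\<close> 70) where
  "s \<ominus> t \<equiv> Fun ''-'' [s, t]"

definition list_trm :: "'v trm list \<Rightarrow> 'v trm" where
  "list_trm ts = foldr (\<bullet>) ts pnil"

datatype 'v literal = Pos 'v | Neg 'v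

text \<open>A CNF formula is a list of clauses, and a clause is a list of literals.\<close>

type_synonym 'v cnf = "'v literal list list"

primrec literal_trm :: "'v literal \<Rightarrow> 'v trm" where
  "literal_trm (Pos x) = tt \<ominus> Var x"
| "literal_trm (Neg x) = ff \<ominus> Var x"

definition cnf_trm :: "'v cnf \<Rightarrow> 'v trm" where
  "cnf_trm F = list_trm (map (\<lambda>C. list_trm (map literal_trm C)) F)"


section \<open>The program\<close>

abbreviation "V_C \<equiv> Var ''C''"
abbreviation "V_Cs \<equiv> Var ''Cs''"
abbreviation "V_P \<equiv> Var ''P''"
abbreviation "V_P1 \<equiv> Var ''P1''"
abbreviation "V_P2 \<equiv> Var ''P2''"
abbreviation "V_R \<equiv> Var ''R''"
abbreviation "V_V \<equiv> Var ''V''"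
abbreviation "V_V1 \<equiv> Var ''V1''"
abbreviation "V_V2 \<equiv> Var ''V2''"
abbreviation "V_Vs \<equiv> Var ''Vs''"
abbreviation "V_X \<equiv> Var ''X''"

definition P\<^sub>3 :: "string program" where
  "P\<^sub>3 = {
    Atom ''sat_cnf'' [pnil] \<longleftarrow> [],
    Atom ''sat_cnf'' [V_C \<bullet> V_Cs] \<longleftarrow> [Atom ''sat_cl'' [V_C], Atom ''sat_cnf'' [V_Cs]],
    Atom ''sat_cl'' [(V_P \<ominus> V_V) \<bullet> V_R] \<longleftarrow> [Atom ''sat_cl3'' [V_R, V_V, V_P]],
    Atom ''='' [V_X, V_X] \<longleftarrow> [],
    Atom ''sat_cl3'' [pnil, V_V, V_P] \<longleftarrow> [Atom ''='' [V_V, V_P]],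
    Atom ''sat_cl3'' [(V_P2 \<ominus> V_V2) \<bullet> V_R, V_V1, V_P1] \<longleftarrow>
      [Atom ''sat_cl5'' [V_V1, V_P1, V_V2, V_P2, V_R]],
    Atom ''sat_cl5'' [V_V1, V_P1, V_V2, V_P2, V_R] \<longleftarrow>
      [Atom ''sat_cl5a'' [V_V1, V_P1, V_V2, V_P2, V_R]],
    Atom ''sat_cl5'' [V_V1, V_P1, V_V2, V_P2, V_R] \<longleftarrow>
      [Atom ''sat_cl5a'' [V_V2, V_P2, V_V1, V_P1, V_R]],
    Atom ''sat_cl5a'' [V_V1, V_P1, V_V2, V_P2, V_R] \<longleftarrow> [Atom ''='' [V_V1, V_P1]],
    Atom ''sat_cl5a'' [V_V1, V_P1, V_V2, V_P2, V_R] \<longleftarrow> [Atom ''sat_cl3'' [V_R, V_V2, V_P2]],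
    Atom ''sat'' [V_Cs, V_Vs] \<longleftarrow> [Atom ''sat_cnf'' [V_Cs], Atom ''tflist'' [V_Vs]],
    Atom ''tflist'' [pnil] \<longleftarrow> [],
    Atom ''tflist'' [V_V \<bullet> V_Vs] \<longleftarrow> [Atom ''tflist'' [V_Vs], Atom ''tf'' [V_V]],
    Atom ''tf'' [tt] \<longleftarrow> [],
    Atom ''tf'' [ff] \<longleftarrow> []}"

definition blocked :: "'v atom \<Rightarrow> bool" where
  "blocked A \<longleftrightarrow> (\<exists>x p y q r. A = Atom ''sat_cl5'' [Var x, p, Var y, q, r])"

end

theory Submission
  imports Defs
begin

text \<open>
  Call the variables in \<open>tf\<close>- and \<open>tflist\<close>-atoms, and in the second argument of \<open>sat\<close>, covered.
  Along every derivation, all literals in the query keep the form \<open>p \<ominus> v\<close> with \<open>p\<close> a truth value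
  and \<open>v\<close> a truth value or a covered variable. A step preserves this: comparing its mgu with an
  explicit unifier shows that covered variables are mapped to variables or truth values, and a
  covered variable disappears only by being bound to a truth value. Hence a query that contains a
  blocked atom also contains the atom covering its first argument, and that atom is not blocked.
\<close>

section \<open>Substitutions\<close>

lemma subst_trm_cong:
  "(\<And>x. x \<in> vars_trm t \<Longrightarrow> \<sigma> x = \<tau> x) \<Longrightarrow> subst_trm \<sigma> t = subst_trm \<tau> t"
  by (induction t) auto

lemma subst_atom_cong:
  assumes "\<And>x. x \<in> vars_atom A \<Longrightarrow> \<sigma> x = \<tau> x"
  shows "subst_atom \<sigma> A = subst_atom \<tau> A"
  using assms by (cases A) (auto intro!: subst_trm_cong)

lemma subst_trm_map_trm: "subst_trm \<sigma> (map_trm \<pi> t) = subst_trm (\<sigma> \<circ> \<pi>) t"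
  by (induction t) auto

lemma subst_atom_map_atom: "subst_atom \<sigma> (map_atom \<pi> A) = subst_atom (\<sigma> \<circ> \<pi>) A"
  by (cases A) (auto simp: subst_trm_map_trm)

lemma vars_subst_trm: "vars_trm (subst_trm \<sigma> t) = (\<Union>x\<in>vars_trm t. vars_trm (\<sigma> x))"
  by (induction t) auto

lemma vars_subst_atom: "vars_atom (subst_atom \<sigma> A) = (\<Union>x\<in>vars_atom A. vars_trm (\<sigma> x))"
  by (cases A) (auto simp: vars_subst_trm)

lemma finite_vars_trm: "finite (vars_trm t)"
  by (induction t) auto

lemma finite_vars_atom: "finite (vars_atom A)"
  by (cases A) (auto simp: finite_vars_trm)

section \<open>Variables along a derivation, and renamed heads\<close>

lemma vars_subst_atom_subset: "vars_atom (subst_atom \<sigma> A) \<subseteq> vars_atom A \<union> vars_subst \<sigma>"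
proof
  fix x assume "x \<in> vars_atom (subst_atom \<sigma> A)"
  then obtain y where "y \<in> vars_atom A" "x \<in> vars_trm (\<sigma> y)"
    by (auto simp: vars_subst_atom)
  then show "x \<in> vars_atom A \<union> vars_subst \<sigma>"
    by (cases "\<sigma> y = Var y") (auto simp: vars_subst_def subst_dom_def)
qed

lemma vars_clause_eq: "vars_clause c = vars_atom (clause_head c) \<union> vars_query (clause_body c)"
  by (cases c) (simp add: vars_query_def)

text \<open>Standardization apart speaks of the initial query and of earlier input clauses and mgus.
  This inclusion turns it into disjointness of the next input clause from the current query.\<close>

lemma sld_fragment_vars:
  assumes "sld_fragment P Q\<^sub>0 ss Q"
  shows "vars_query Q \<subseteq> vars_query Q\<^sub>0 \<union>
    (\<Union>s\<in>set ss. vars_clause (step_clause s) \<union> vars_subst (step_mgu s))"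
  using assms
proof induction
  case start
  then show ?case by simp
next
  case (step ss Q i c\<^sub>0 c \<theta>)
  let ?ss = "ss @ [Step Q i c \<theta>]"
  have "vars_query (map (subst_atom \<theta>) (take i Q @ clause_body c @ drop (Suc i) Q))
      \<subseteq> vars_query Q \<union> vars_clause c \<union> vars_subst \<theta>"
  proof
    fix x assume "x \<in> vars_query (map (subst_atom \<theta>) (take i Q @ clause_body c @ drop (Suc i) Q))"
    then obtain A where A: "A \<in> set (take i Q @ clause_body c @ drop (Suc i) Q)"
      and x: "x \<in> vars_atom (subst_atom \<theta> A)"
      by (auto simp: vars_query_def)
    from A have "A \<in> set Q \<or> A \<in> set (clause_body c)"
      by (auto dest: in_set_takeD in_set_dropD)
    then have "vars_atom A \<subseteq> vars_query Q \<union> vars_clause c"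
      by (auto simp: vars_query_def vars_clause_eq)
    then show "x \<in> vars_query Q \<union> vars_clause c \<union> vars_subst \<theta>"
      using x vars_subst_atom_subset[of \<theta> A] by blast
  qed
  also have "\<dots> \<subseteq> vars_query Q\<^sub>0 \<union>
      (\<Union>s\<in>set ?ss. vars_clause (step_clause s) \<union> vars_subst (step_mgu s))"
    using step.IH by auto
  finally show ?case .
qed

text \<open>As \<open>A\<close> and the renamed head share no variable, \<open>\<rho>\<close> on the
  variables of \<open>A\<close> and \<open>\<tau>\<close> on those of the head can be glued into one
  unifier, through which the mgu factors. The rule can thus be treated without its renaming.\<close>

lemma mgu_more_general_outside_clause:
  assumes "mgu \<theta> A (map_atom \<pi> H)" and "inj \<pi>"
    and "vars_atom A \<inter> vars_atom (map_atom \<pi> H) = {}"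
    and "finite (subst_dom \<rho>)" and "subst_atom \<rho> A = subst_atom \<tau> H"
  shows "\<exists>\<delta>. \<forall>x. x \<notin> vars_atom (map_atom \<pi> H) \<longrightarrow> \<rho> x = subst_trm \<delta> (\<theta> x)"
proof -
  let ?V = "vars_atom (map_atom \<pi> H)"
  \<comment> \<open>\<open>inv \<pi>\<close> leads from a renamed head variable back to the variable
    of the rule on which \<open>\<tau>\<close> acts.\<close>
  define \<sigma> where "\<sigma> x = (if x \<in> ?V then \<tau> (inv \<pi> x) else \<rho> x)" for x
  have "subst_dom \<sigma> \<subseteq> ?V \<union> subst_dom \<rho>"
    by (auto simp: subst_dom_def \<sigma>_def)
  then have "finite (subst_dom \<sigma>)"
    using assms(4) finite_vars_atom by (meson finite_Un finite_subset)
  moreover have "subst_atom \<sigma> A = subst_atom \<rho> A"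
    using assms(3) by (intro subst_atom_cong) (auto simp: \<sigma>_def)
  moreover have "subst_atom \<sigma> (map_atom \<pi> H) = subst_atom \<tau> H"
    unfolding subst_atom_map_atom
    using \<open>inj \<pi>\<close> by (intro subst_atom_cong) (auto simp: \<sigma>_def atom.set_map)
  ultimately have "unifier \<sigma> A (map_atom \<pi> H)"
    using assms(5) by (simp add: unifier_def)
  then obtain \<delta> where "\<forall>x. \<sigma> x = subst_trm \<delta> (\<theta> x)"
    using assms(1) unfolding mgu_def by blast
  then have "\<forall>x. x \<notin> ?V \<longrightarrow> \<rho> x = subst_trm \<delta> (\<theta> x)"
    by (metis \<sigma>_def)
  then show ?thesis by blast
qed


section \<open>The invariant\<close>

definition truth :: "'v trm \<Rightarrow> bool" where
  "truth t \<longleftrightarrow> t = tt \<or> t = ff"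

text \<open>\<open>W\<close> is the set of covered variables, or \<open>UNIV\<close> while it is not
  yet known that a variable is covered.\<close>

definition val :: "'v set \<Rightarrow> 'v trm \<Rightarrow> bool" where
  "val W t \<longleftrightarrow> truth t \<or> (\<exists>x\<in>W. t = Var x)"

definition lit :: "'v set \<Rightarrow> 'v trm \<Rightarrow> bool" where
  "lit W t \<longleftrightarrow> (\<exists>p v. t = p \<ominus> v \<and> truth p \<and> val W v)"

text \<open>Only lists closed by \<open>pnil\<close> qualify, so resolution never has to bind a list
  tail.\<close>

inductive listof :: "('v trm \<Rightarrow> bool) \<Rightarrow> 'v trm \<Rightarrow> bool" for E where
  "listof E pnil"
| "E h \<Longrightarrow> listof E t \<Longrightarrow> listof E (h \<bullet> t)"

text \<open>Covering is a property of the whole query, so \<open>W\<close> is a parameter here and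
  is set to \<open>cov Q\<close> later. Polarities are required to be truth values, which every
  substitution fixes.\<close>

inductive good :: "'v set \<Rightarrow> 'v atom \<Rightarrow> bool" for W where
  "listof (listof (lit W)) u \<Longrightarrow> listof (val W) l \<Longrightarrow> good W (Atom ''sat'' [u, l])"
| "listof (listof (lit W)) u \<Longrightarrow> good W (Atom ''sat_cnf'' [u])"
| "listof (lit W) c \<Longrightarrow> good W (Atom ''sat_cl'' [c])"
| "listof (lit W) r \<Longrightarrow> val W v \<Longrightarrow> truth p \<Longrightarrow> good W (Atom ''sat_cl3'' [r, v, p])"
| "val W v1 \<Longrightarrow> truth p1 \<Longrightarrow> val W v2 \<Longrightarrow> truth p2 \<Longrightarrow> listof (lit W) r \<Longrightarrow>
    good W (Atom ''sat_cl5'' [v1, p1, v2, p2, r])"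
| "val W v1 \<Longrightarrow> truth p1 \<Longrightarrow> val W v2 \<Longrightarrow> truth p2 \<Longrightarrow> listof (lit W) r \<Longrightarrow>
    good W (Atom ''sat_cl5a'' [v1, p1, v2, p2, r])"
| "val W v \<Longrightarrow> truth p \<Longrightarrow> good W (Atom ''='' [v, p])"
| "listof (val W) l \<Longrightarrow> good W (Atom ''tflist'' [l])"
| "val W v \<Longrightarrow> good W (Atom ''tf'' [v])"

definition cov_atom :: "'v atom \<Rightarrow> 'v set" where
  "cov_atom A = \<Union>{vars_trm t | t. A = Atom ''tf'' [t] \<or> A = Atom ''tflist'' [t] \<or>
                              (\<exists>u. A = Atom ''sat'' [u, t])}"

definition cov :: "'v query \<Rightarrow> 'v set" where
  "cov Q = (\<Union>A\<in>set Q. cov_atom A)"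

inductive_simps listof_Cons: "listof E (h \<bullet> t)"
inductive_simps good_Atom: "good W (Atom p ts)"

lemma truth_simps [simp]: "truth tt" "truth ff" "\<not> truth (Var x)"
  by (auto simp: truth_def)

lemma truth_subst [simp]: "truth p \<Longrightarrow> subst_trm \<sigma> p = p"
  by (auto simp: truth_def)

lemma val_truth [simp]: "truth t \<Longrightarrow> val W t"
  by (simp add: val_def)

lemma lit_minus: "lit W (p \<ominus> v) \<longleftrightarrow> truth p \<and> val W v"
  by (auto simp: lit_def)

lemma listof_subst:
  assumes "listof E t" and "\<And>h. E h \<Longrightarrow> E' (subst_trm \<sigma> h)"
  shows "listof E' (subst_trm \<sigma> t)"
  using assms by induction (auto intro: listof.intros)

lemma listof_list_trm: "(\<And>t. t \<in> set ts \<Longrightarrow> E t) \<Longrightarrow> listof E (list_trm ts)"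
  by (induction ts) (auto simp: list_trm_def intro: listof.intros)

lemma cov_subset_vars: "cov Q \<subseteq> vars_query Q"
  by (force simp: cov_def cov_atom_def vars_query_def)

context
  fixes \<sigma> :: "'v subst" and W W' :: "'v set"
  assumes val_\<sigma>: "\<And>x. x \<in> W \<Longrightarrow> val W' (\<sigma> x)"
begin

lemma val_subst: "val W t \<Longrightarrow> val W' (subst_trm \<sigma> t)"
  using val_\<sigma> by (auto simp: val_def[of W])

lemma lit_subst: "lit W t \<Longrightarrow> lit W' (subst_trm \<sigma> t)"
  using val_subst by (auto simp: lit_def)

text \<open>Apart from list structure and truth values, which substitutions keep, goodness depends
  only on \<open>val\<close>, and \<open>\<sigma>\<close> sends \<open>W\<close> to values over
  \<open>W'\<close>.\<close>

lemma good_subst: "good W A \<Longrightarrow> good W' (subst_atom \<sigma> A)"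
  by (induction rule: good.induct)
    (auto intro!: good.intros intro: listof_subst lit_subst val_subst)

end


section \<open>Steps of the program\<close>

text \<open>Each body is built from parts of its head. The rule that swaps the two literals is
  harmless because the conditions on \<open>sat_cl5\<close> and \<open>sat_cl5a\<close> are the same
  and symmetric in the two pairs.\<close>

lemma instance_of_rule_good:
  assumes "c\<^sub>0 \<in> P\<^sub>3" and "good W (subst_atom \<sigma> (clause_head c\<^sub>0))" and "B \<in> set (clause_body c\<^sub>0)"
  shows "good W (subst_atom \<sigma> B)"
  using assms unfolding P\<^sub>3_def
  by (elim insertE emptyE) (auto simp: good_Atom listof_Cons lit_minus)

text \<open>\<open>sat\<close> and \<open>tflist\<close> hand their covered variables on to the
  body. The heads of the \<open>tf\<close> facts are ground, and the remaining predicates cover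
  nothing.\<close>

lemma instance_of_rule_cov:
  assumes "c\<^sub>0 \<in> P\<^sub>3"
  shows "cov_atom (subst_atom \<sigma> (clause_head c\<^sub>0)) \<subseteq> cov (map (subst_atom \<sigma>) (clause_body c\<^sub>0))"
  using assms unfolding P\<^sub>3_def cov_def cov_atom_def
  by (elim insertE emptyE) auto

section \<open>Unifying good atoms with rule heads\<close>

lemma subst_Var: "subst_trm Var t = t" "subst_atom Var A = A"
proof -
  show *: "subst_trm Var t = t" for t :: "'v trm"
    by (induction t) (auto intro: map_idI)
  show "subst_atom Var A = A"
    by (cases A) (auto simp: * intro: map_idI)
qed

lemma finite_subst_dom_update: "finite (subst_dom (Var(x := t)))"
  by (rule finite_subset[of _ "{x}"]) (auto simp: subst_dom_def)

lemma listof_subst_nil: "subst_trm \<theta> t = pnil \<Longrightarrow> listof E t \<Longrightarrow> t = pnil"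
  by (auto elim: listof.cases)

text \<open>A closed list is never a variable, so the top constructor seen in the instance is
  already present in \<open>t\<close>.\<close>

lemma listof_subst_cons: "subst_trm \<theta> t = a \<bullet> b \<Longrightarrow> listof E t \<Longrightarrow> \<exists>h r. t = h \<bullet> r \<and> E h"
  by (auto elim: listof.cases)

text \<open>
  Only the rules for \<open>=\<close> and \<open>tf\<close> need a \<open>\<rho>\<close> other than the identity: the atoms resolved with the
  other rules are instances of their heads.
\<close>

lemma good_atom_unifies_by_values:
  assumes "c\<^sub>0 \<in> P\<^sub>3" and "good W A" and "subst_atom \<theta> A = subst_atom \<sigma> (clause_head c\<^sub>0)"
  shows "\<exists>\<rho> \<tau>. finite (subst_dom \<rho>) \<and> (\<forall>x. val UNIV (\<rho> x)) \<and>
    subst_atom \<rho> A = subst_atom \<tau> (clause_head c\<^sub>0)"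
proof -
  have update: "finite (subst_dom (Var(y := t))) \<and> (\<forall>x. val UNIV ((Var(y := t)) x))"
    if "truth t" for y and t :: "string trm"
    using that finite_subst_dom_update by (auto simp: val_def)
  have inst: ?thesis if "A = subst_atom \<tau> (clause_head c\<^sub>0)" for \<tau>
    using that by (intro exI[of _ Var] exI[of _ \<tau>]) (auto simp: subst_Var subst_dom_def val_def)
  have sat_cnf_Cons: ?thesis if H: "clause_head c\<^sub>0 = Atom ''sat_cnf'' [V_C \<bullet> V_Cs]"
  proof -
    obtain c cs where "A = Atom ''sat_cnf'' [c \<bullet> cs]"
      using assms(2,3) H by (cases A) (auto simp: good_Atom dest: listof_subst_cons)
    \<comment> \<open>The base \<open>undefined\<close> has no effect on the head, since all its
      variables are updated. The other witnesses built this way work alike.\<close>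
    then show ?thesis
      using H by (intro inst[of "(\<lambda>_. undefined)(''C'' := c, ''Cs'' := cs)"]) simp
  qed
  have sat_cl: ?thesis if H: "clause_head c\<^sub>0 = Atom ''sat_cl'' [(V_P \<ominus> V_V) \<bullet> V_R]"
  proof -
    obtain t r where "A = Atom ''sat_cl'' [t \<bullet> r]" "lit W t"
      using assms(2,3) H by (cases A) (auto simp: good_Atom dest: listof_subst_cons)
    then obtain p v where "A = Atom ''sat_cl'' [(p \<ominus> v) \<bullet> r]"
      by (auto simp: lit_def)
    then show ?thesis
      using H by (intro inst[of "(\<lambda>_. undefined)(''P'' := p, ''V'' := v, ''R'' := r)"]) simp
  qed
  have eq: ?thesis if H: "clause_head c\<^sub>0 = Atom ''='' [V_X, V_X]"
  proof -
    obtain v p where A: "A = Atom ''='' [v, p]" and v: "val W v" and p: "truth p"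
      and vp: "subst_trm \<theta> v = p"
      using assms(2,3) H by (cases A) (auto simp: good_Atom)
    from v[unfolded val_def] show ?thesis
    proof (elim disjE bexE)
      \<comment> \<open>A truth value is fixed by \<open>\<theta>\<close>, so \<open>v\<close>
        equals \<open>p\<close> and the atom is an instance of the head.\<close>
      assume "truth v"
      then show ?thesis using vp A H by (intro inst[of "\<lambda>_. p"]) simp
    next
      fix x assume "v = Var x"
      then show ?thesis
        \<comment> \<open>Binding the single variable \<open>x\<close> to \<open>p\<close> makes
          both sides equal and keeps every image a value.\<close>
        using A H p update[OF p] by (intro exI[of _ "Var(x := p)"] exI[of _ "\<lambda>_. p"]) simp
    qed
  qed
  have sat_cl3_Nil: ?thesis if H: "clause_head c\<^sub>0 = Atom ''sat_cl3'' [pnil, V_V, V_P]"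
  proof -
    obtain v p where "A = Atom ''sat_cl3'' [pnil, v, p]"
      using assms(2,3) H by (cases A) (auto simp: good_Atom dest: listof_subst_nil)
    then show ?thesis
      using H by (intro inst[of "(\<lambda>_. undefined)(''V'' := v, ''P'' := p)"]) simp
  qed
  have sat_cl3_Cons: ?thesis
    if H: "clause_head c\<^sub>0 = Atom ''sat_cl3'' [(V_P2 \<ominus> V_V2) \<bullet> V_R, V_V1, V_P1]"
  proof -
    obtain t r v1 p1 where "A = Atom ''sat_cl3'' [t \<bullet> r, v1, p1]" "lit W t"
      using assms(2,3) H by (cases A) (auto simp: good_Atom dest: listof_subst_cons)
    then obtain p2 v2 where "A = Atom ''sat_cl3'' [(p2 \<ominus> v2) \<bullet> r, v1, p1]"
      by (auto simp: lit_def)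
    then show ?thesis
      using H by (intro inst[of "(\<lambda>_. undefined)(''P2'' := p2, ''V2'' := v2, ''R'' := r,
        ''V1'' := v1, ''P1'' := p1)"]) simp
  qed
  \<comment> \<open>The heads for \<open>sat_cl5\<close> and \<open>sat_cl5a\<close> have the same
    arguments; \<open>f\<close> stands for either symbol.\<close>
  have sat_cl5: ?thesis if H: "clause_head c\<^sub>0 = Atom f [V_V1, V_P1, V_V2, V_P2, V_R]" for f
  proof -
    obtain v1 p1 v2 p2 r where "A = Atom f [v1, p1, v2, p2, r]"
      using assms(2,3) H by (cases A) (auto simp: good_Atom)
    then show ?thesis
      using H by (intro inst[of "(\<lambda>_. undefined)(''P2'' := p2, ''V2'' := v2, ''R'' := r,
        ''V1'' := v1, ''P1'' := p1)"]) simp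
  qed
  have sat: ?thesis if H: "clause_head c\<^sub>0 = Atom ''sat'' [V_Cs, V_Vs]"
  proof -
    obtain u l where "A = Atom ''sat'' [u, l]"
      using assms(2,3) H by (cases A) (auto simp: good_Atom)
    then show ?thesis
      using H by (intro inst[of "(\<lambda>_. undefined)(''Cs'' := u, ''Vs'' := l)"]) simp
  qed
  have tflist_Cons: ?thesis if H: "clause_head c\<^sub>0 = Atom ''tflist'' [V_V \<bullet> V_Vs]"
  proof -
    obtain v l where "A = Atom ''tflist'' [v \<bullet> l]"
      using assms(2,3) H by (cases A) (auto simp: good_Atom dest: listof_subst_cons)
    then show ?thesis
      using H by (intro inst[of "(\<lambda>_. undefined)(''V'' := v, ''Vs'' := l)"]) simp
  qed
  \<comment> \<open>Restricting \<open>f\<close> ensures that the argument is a closed list; a good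
    \<open>tf\<close>-atom could have a variable there.\<close>
  have Nil: ?thesis if H: "clause_head c\<^sub>0 = Atom f [pnil]" and f: "f = ''sat_cnf'' \<or> f = ''tflist''" for f
  proof -
    have "A = Atom f [pnil]"
      using assms(2,3) H f by (cases A) (auto simp: good_Atom dest: listof_subst_nil)
    then show ?thesis using H by (intro inst) simp
  qed
  have tf: ?thesis if H: "clause_head c\<^sub>0 = Atom ''tf'' [t]" and t: "truth t" for t
  proof -
    obtain v where A: "A = Atom ''tf'' [v]" and v: "val W v" and vt: "subst_trm \<theta> v = t"
      using assms(2,3) H t by (cases A) (auto simp: good_Atom)
    from v[unfolded val_def] show ?thesis
    proof (elim disjE bexE)
      assume "truth v"
      then show ?thesis using vt A H t by (intro inst) simp
    next
      fix x assume "v = Var x"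
      then show ?thesis
        using A H t update[OF t] by (intro exI[of _ "Var(x := t)"]) simp
    qed
  qed
  show ?thesis
    using assms(1) unfolding P\<^sub>3_def
  proof (elim insertE emptyE)
  qed (rule Nil[of "''sat_cnf''"] Nil[of "''tflist''"] sat_cnf_Cons sat_cl eq sat_cl3_Nil
        sat_cl3_Cons sat_cl5[of "''sat_cl5''"] sat_cl5[of "''sat_cl5a''"] sat tflist_Cons
        tf[of tt] tf[of ff]; simp; fail)+
qed

text \<open>\<open>\<theta> x\<close> has the value \<open>\<rho> x\<close> as an instance, so it
  must itself be a variable or a truth value. Variables of the head are excluded because the mgu may
  bind them to lists.\<close>

lemma mgu_maps_to_values:
  fixes A :: "string atom"
  assumes "c\<^sub>0 \<in> P\<^sub>3" and "bij \<pi>" and "mgu \<theta> A (map_atom \<pi> (clause_head c\<^sub>0))" and "good W A"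
    and "vars_atom A \<inter> vars_atom (map_atom \<pi> (clause_head c\<^sub>0)) = {}"
    and "x \<notin> vars_atom (map_atom \<pi> (clause_head c\<^sub>0))"
  shows "val UNIV (\<theta> x)"
proof -
  have "subst_atom \<theta> A = subst_atom (\<theta> \<circ> \<pi>) (clause_head c\<^sub>0)"
    using assms(3) by (simp add: mgu_def unifier_def subst_atom_map_atom)
  from good_atom_unifies_by_values[OF assms(1,4) this]
  obtain \<rho> \<tau> where \<rho>: "finite (subst_dom \<rho>)" "\<And>x. val UNIV (\<rho> x)"
    and eq: "subst_atom \<rho> A = subst_atom \<tau> (clause_head c\<^sub>0)"
    by blast
  obtain \<delta> where "\<rho> x = subst_trm \<delta> (\<theta> x)"
    using mgu_more_general_outside_clause[OF assms(3) bij_is_inj[OF assms(2)] assms(5) \<rho>(1) eq]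
      assms(6) by blast
  then have "val UNIV (subst_trm \<delta> (\<theta> x))"
    using \<rho>(2)[of x] by simp
  then show ?thesis
    by (cases "\<theta> x") (auto simp: val_def truth_def)
qed

section \<open>Preservation of the invariant by one step\<close>

lemma vars_cov_subst_atom: "x \<in> cov_atom A \<Longrightarrow> vars_trm (\<theta> x) \<subseteq> cov_atom (subst_atom \<theta> A)"
  by (cases A) (fastforce simp: cov_atom_def vars_subst_trm)

lemma step_preserves_good:
  fixes Q Q' :: "string query"
  assumes good: "\<And>A. A \<in> set Q \<Longrightarrow> good (cov Q) A"
    and "i < length Q" and "c\<^sub>0 \<in> P\<^sub>3" and "variant c c\<^sub>0"
    and apart: "vars_clause c \<inter> vars_query Q = {}"
    and "mgu \<theta> (Q ! i) (clause_head c)"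
    and Q': "Q' = map (subst_atom \<theta>) (take i Q @ clause_body c @ drop (Suc i) Q)"
    and "A \<in> set Q'"
  shows "good (cov Q') A"
proof -
  obtain \<pi> where "bij \<pi>" and c: "c = map_clause \<pi> c\<^sub>0"
    using \<open>variant c c\<^sub>0\<close> by (auto simp: variant_def)
  have head: "clause_head c = map_atom \<pi> (clause_head c\<^sub>0)"
    and body: "clause_body c = map (map_atom \<pi>) (clause_body c\<^sub>0)"
    unfolding c by (cases c\<^sub>0; simp)+
  have Qi: "Q ! i \<in> set Q" using \<open>i < length Q\<close> by simp
  have unif: "subst_atom \<theta> (Q ! i) = subst_atom (\<theta> \<circ> \<pi>) (clause_head c\<^sub>0)"
    using \<open>mgu _ _ _\<close> by (simp add: mgu_def unifier_def head subst_atom_map_atom)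
  have disj: "vars_query Q \<inter> vars_atom (clause_head c) = {}"
    using apart by (auto simp: vars_clause_eq)
  \<comment> \<open>What the selected atom covered after instantiation is still covered by the body
    that replaces it.\<close>
  have cov_Qi: "cov_atom (subst_atom \<theta> (Q ! i)) \<subseteq> cov (map (subst_atom \<theta>) (clause_body c))"
    using instance_of_rule_cov[OF \<open>c\<^sub>0 \<in> P\<^sub>3\<close>, of "\<theta> \<circ> \<pi>"]
    by (simp add: unif body subst_atom_map_atom comp_def)
  have covered: "vars_trm (\<theta> x) \<subseteq> cov Q'" if x: "x \<in> cov Q" for x
  proof -
    obtain B where "B \<in> set Q" and "x \<in> cov_atom B"
      using x by (auto simp: cov_def)
    moreover have "set Q = set (take i Q @ Q ! i # drop (Suc i) Q)"
      using id_take_nth_drop[OF \<open>i < length Q\<close>] by (rule arg_cong)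
    ultimately have "B \<in> set (take i Q) \<or> B = Q ! i \<or> B \<in> set (drop (Suc i) Q)"
      unfolding set_append list.set by blast
    then have "cov_atom (subst_atom \<theta> B) \<subseteq> cov Q'"
      using cov_Qi unfolding Q' cov_def by auto
    then show ?thesis
      using vars_cov_subst_atom[OF \<open>x \<in> cov_atom B\<close>] by blast
  qed
  have val_\<theta>: "val (cov Q') (\<theta> x)" if "x \<in> cov Q" for x
  proof -
    have "x \<in> vars_query Q" using that by (rule subsetD[OF cov_subset_vars])
    moreover have "vars_atom (Q ! i) \<subseteq> vars_query Q"
      using Qi by (auto simp: vars_query_def)
    ultimately have "val UNIV (\<theta> x)"
      using mgu_maps_to_values[OF \<open>c\<^sub>0 \<in> P\<^sub>3\<close> \<open>bij \<pi>\<close> _ good[OF Qi]] \<open>mgu _ _ _\<close> disj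
      unfolding head by blast
    \<comment> \<open>If the value \<open>\<theta> x\<close> is a variable, \<open>covered\<close>
      places that variable in \<open>cov Q'\<close>.\<close>
    then show ?thesis
      using covered[OF that] by (auto simp: val_def)
  qed
  have old: "good (cov Q') (subst_atom \<theta> B)" if "B \<in> set Q" for B
    using good_subst[OF val_\<theta> good[OF that]] .
  \<comment> \<open>The instance of the selected atom is good over \<open>cov Q'\<close> although it
    has left the query. It equals the instance of the rule head, so goodness passes to the
    body.\<close>
  have new: "good (cov Q') (subst_atom \<theta> (map_atom \<pi> B))" if "B \<in> set (clause_body c\<^sub>0)" for B
    using instance_of_rule_good[OF \<open>c\<^sub>0 \<in> P\<^sub>3\<close> _ that] old[OF Qi]
    unfolding unif subst_atom_map_atom by blast
  show ?thesis
    using \<open>A \<in> set Q'\<close> old new unfolding Q' body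
    by (auto dest: in_set_takeD in_set_dropD)
qed

section \<open>The invariant along derivations\<close>

lemma sld_fragment_good:
  assumes "sld_fragment P\<^sub>3 Q\<^sub>0 ss Q" and "\<And>A. A \<in> set Q\<^sub>0 \<Longrightarrow> good (cov Q\<^sub>0) A" and "A \<in> set Q"
  shows "good (cov Q) A"
  using assms(1,3)
proof (induction arbitrary: A)
  case start
  then show ?case using assms(2) by blast
next
  case (step ss Q i c\<^sub>0 c \<theta>)
  have "vars_clause c \<inter> vars_query Q = {}"
    using sld_fragment_vars[OF step.hyps(1)] step.hyps(5) by blast
  then show ?case
    using step_preserves_good[OF step.IH step.hyps(2-4) _ step.hyps(6) refl step.prems] by blast
qed

text \<open>The variable in the first argument of a good blocked atom is covered, and every covering
  atom is a \<open>tf\<close>-, \<open>tflist\<close>- or \<open>sat\<close>-atom, hence not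
  blocked.\<close>

lemma good_blocked_unblocked:
  assumes "good (cov Q) A" and "blocked A"
  shows "\<exists>B\<in>set Q. \<not> blocked B"
proof -
  from \<open>blocked A\<close> obtain x p y q r where "A = Atom ''sat_cl5'' [Var x, p, Var y, q, r]"
    by (auto simp: blocked_def)
  with assms(1) have "x \<in> cov Q"
    by (simp add: good_Atom val_def)
  then obtain B where "B \<in> set Q" and "x \<in> cov_atom B"
    by (auto simp: cov_def)
  moreover from \<open>x \<in> cov_atom B\<close> have "\<not> blocked B"
    by (auto simp: cov_atom_def blocked_def)
  ultimately show ?thesis by blast
qed

lemma vars_list_trm: "vars_trm (list_trm ts) = (\<Union>t\<in>set ts. vars_trm t)"
  by (induction ts) (auto simp: list_trm_def)

lemma initial_query_good:
  assumes "set vs = vars_trm (cnf_trm F)"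
  defines "Q \<equiv> [Atom ''sat'' [cnf_trm F, list_trm (map Var vs)]]"
  assumes "A \<in> set Q"
  shows "good (cov Q) A"
proof -
  \<comment> \<open>Only the second argument of \<open>sat\<close> counts as covering; by assumption
    it lists all variables of the formula.\<close>
  have cov: "cov Q = set vs"
    by (auto simp: Q_def cov_def cov_atom_def vars_list_trm)
  have "lit (set vs) (literal_trm L)" if "C \<in> set F" "L \<in> set C" for C L
  proof -
    have "vars_trm (literal_trm L) \<subseteq> set vs"
      using that assms(1) by (force simp: cnf_trm_def vars_list_trm)
    then show ?thesis by (cases L) (auto simp: lit_minus val_def)
  qed
  then show ?thesis
    using assms(3) unfolding cov
    by (auto simp: Q_def cnf_trm_def val_def intro!: good.intros listof_list_trm)
qed

theorem mainTheorem4: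
  fixes R :: "string selection_rule"
    and F :: "string cnf" and u l :: "string trm" and vs :: "string list"
  assumes "partial_selection_rule P\<^sub>3 R"
    and "\<And>Q ss Q' i. sld_fragment P\<^sub>3 Q ss Q' \<Longrightarrow> R ss Q' = Some i \<Longrightarrow> \<not> blocked (Q' ! i)"
    and "\<And>Q ss Q'. sld_fragment P\<^sub>3 Q ss Q' \<Longrightarrow> \<exists>A\<in>set Q'. \<not> blocked A \<Longrightarrow> \<exists>i. R ss Q' = Some i"
    and "u = cnf_trm F"
    and "l = list_trm (map Var vs)" and "set vs = vars_trm u"
    and "Q\<^sub>0 = [Atom ''sat'' [u, l]]"
  shows "\<forall>d. sld_derivation_via P\<^sub>3 R Q\<^sub>0 d \<longrightarrow> \<not> flounders R d"
proof (intro allI impI notI)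
  fix d assume "sld_derivation_via P\<^sub>3 R Q\<^sub>0 d" and "flounders R d"
  then obtain ss Q where "sld_fragment_via P\<^sub>3 R Q\<^sub>0 ss Q" and "Q \<noteq> []" and "R ss Q = None"
    unfolding flounders_def sld_derivation_via_def by blast
  then have frag: "sld_fragment P\<^sub>3 Q\<^sub>0 ss Q"
    by (simp add: sld_fragment_via_def)
  \<comment> \<open>Were some atom not blocked, the rule would have to select an atom in
    \<open>Q\<close>.\<close>
  have blocked: "\<forall>A\<in>set Q. blocked A"
    using assms(3)[OF frag] \<open>R ss Q = None\<close> by auto
  obtain A where "A \<in> set Q" using \<open>Q \<noteq> []\<close> by (cases Q) auto
  moreover have "good (cov Q\<^sub>0) B" if "B \<in> set Q\<^sub>0" for B
    using initial_query_good[of vs F B] that assms(4-7) by simp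
  ultimately have "good (cov Q) A"
    using sld_fragment_good[OF frag] by blast
  then show False
    using good_blocked_unblocked blocked \<open>A \<in> set Q\<close> by blast
qed

end
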